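(* Let $d\ge 1$ be an integer, let $\xi_1,\dots,\xi_d\in\mathbb{R}$, and put $\Xi=(\xi_1,\dots,\xi_d,\ \xi_1^2+\dots+\xi_d^2)\in\mathbb{R}^{d+1}$. Suppose that $\Xi$ is totally irrational, i.e. $1,\xi_1,\dots,\xi_d,\ \xi_1^2+\dots+\xi_d^2$ are linearly independent over $\mathbb{Z}$. Then $\hat{\omega}(\Xi)\le H_d$, where $H_d$ is the unique positive root of $x^{d+1}+x^{d}+\dots+x=1$.
   Context: For $\Theta=(\theta_1,\dots,\theta_m)\in\mathbb{R}^m$, the uniform Diophantine exponent $\hat{\omega}(\Theta)$ is the supremum of all real $\gamma$ such that for every sufficiently large real $Q$ the system $\max_{1\le j\le m}|q\theta_j-a_j|<Q^{-\gamma}$, $1\le q\le Q$, has a solution $(q,a_1,\dots,a_m)\in\mathbb{Z}^{m+1}$. *)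

theory Defs
  imports "HOL-Analysis.Analysis"
begin

text \<open>A point of \<open>\<real>\<^sup>m\<close> is a function \<open>\<theta> :: nat \<Rightarrow> real\<close> of which only the values
  \<open>\<theta> 1, \<dots>, \<theta> m\<close> are used.\<close>

text \<open>The supremum is taken in the extended reals, so that it is \<open>\<infinity>\<close> (and not an
  unspecified real) when the set of admissible \<open>\<gamma>\<close> is unbounded above, as for
  rational \<open>\<theta>\<close>. For \<open>m \<ge> 1\<close> the value \<open>\<gamma> = 0\<close> is always admissible.\<close>

definition uniform_exponent :: "nat \<Rightarrow> (nat \<Rightarrow> real) \<Rightarrow> ereal" where
  "uniform_exponent m \<theta> = Sup {ereal \<gamma> | \<gamma>.
     \<forall>\<^sub>F Q in (at_top :: real filter). \<exists>(q :: int) (a :: nat \<Rightarrow> int).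
       1 \<le> q \<and> of_int q \<le> Q \<and>
       (MAX j\<in>{1..m}. \<bar>of_int q * \<theta> j - of_int (a j)\<bar>) < Q powr (- \<gamma>)}"

text \<open>Linear independence of the family \<open>1, \<theta> 1, \<dots>, \<theta> m\<close> (with repetitions
  counting as dependences) over the integers.\<close>

definition totally_irrational :: "nat \<Rightarrow> (nat \<Rightarrow> real) \<Rightarrow> bool" where
  "totally_irrational m \<theta> \<longleftrightarrow>
     (\<forall>(c\<^sub>0 :: int) (c :: nat \<Rightarrow> int).
        of_int c\<^sub>0 + (\<Sum>j = 1..m. of_int (c j) * \<theta> j) = 0 \<longrightarrow>
        c\<^sub>0 = 0 \<and> (\<forall>j\<in>{1..m}. c j = 0))"

definition paraboloid_point :: "nat \<Rightarrow> (nat \<Rightarrow> real) \<Rightarrow> nat \<Rightarrow> real" where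
  "paraboloid_point d \<xi> j = (if j \<le> d then \<xi> j else (\<Sum>i = 1..d. (\<xi> i)\<^sup>2))"

definition H :: "nat \<Rightarrow> real" where
  "H d = (THE x. x > 0 \<and> (\<Sum>k = 1..d + 1. x ^ k) = 1)"

lemma ex1_positive_root: "\<exists>!x::real. x > 0 \<and> (\<Sum>k = 1..d + 1. x ^ k) = 1"
proof -
  let ?f = "\<lambda>x::real. \<Sum>k = 1..d + 1. x ^ k"
  have mono: "?f x < ?f y" if "0 < x" "x < y" for x y :: real
    using that by (intro sum_strict_mono power_strict_mono) auto
  have zero: "?f 0 = 0"
    by (intro sum.neutral) auto
  have "?f 1 = real (d + 1)"
    by simp
  then have "\<exists>x\<ge>0. x \<le> 1 \<and> ?f x = 1"
    by (intro IVT') (use zero in \<open>auto intro!: continuous_intros\<close>)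
  then obtain x where x: "0 \<le> x" "?f x = 1"
    by blast
  have "x \<noteq> 0"
    using x(2) zero by (metis zero_neq_one)
  with x have "0 < x \<and> ?f x = 1"
    by simp
  moreover have "y = x" if "0 < y \<and> ?f y = 1" for y
    using mono[of x y] mono[of y x] that \<open>0 < x \<and> ?f x = 1\<close>
    by (metis less_irrefl linorder_neqE_linordered_idom)
  ultimately show ?thesis
    by blast
qed

end

theory Submission
  imports Defs "Jordan_Normal_Form.Determinant"
begin

text \<open>Let \<open>z\<^sub>k = (q\<^sub>k, a\<^sub>1, \<dots>, a\<^sub>d, b)\<close> be the best approximations to \<open>\<Xi>\<close>, with errors \<open>L\<^sub>k\<close>, and
  suppose \<open>L\<^sub>k \<lless> q\<^sub>k\<^sub>+\<^sub>1\<close> to the power \<open>-\<alpha>\<close> with \<open>\<alpha> > H\<^sub>d > 1/2\<close>. The form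
  \<open>F(z) = \<Sum> a\<^sub>i\<^sup>2 - q b\<close> is an integer of size \<open>O(q\<^sub>k L\<^sub>k)\<close>, so \<open>q\<^sub>k L\<^sub>k \<ggreater> 1\<close> unless \<open>F(z\<^sub>k) = 0\<close>.
  If \<open>z = z\<^sub>k\<close> is isotropic, compare it with \<open>z' = z\<^sub>k\<^sub>-\<^sub>1\<close>: the sum of the squares of
  \<open>q' a\<^sub>i - q a'\<^sub>i\<close> is divisible by \<open>q\<close>, and if it vanishes then so is the square of the nonzero
  integer \<open>q' b - q b'\<close>; both are too small for that, because \<open>\<alpha> > 1/2\<close>. Hence
  \<open>q\<^sub>k\<close> is eventually at least a constant times the \<open>\<alpha>\<close>-th power of \<open>q\<^sub>k\<^sub>+\<^sub>1\<close>.

  Now pick \<open>d + 2\<close> independent vectors greedily from a tail of the sequence: the next one is the first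
  \<open>z\<^sub>k\<^sub>+\<^sub>1\<close> outside the span \<open>V\<close> of the previous ones. As \<open>z\<^sub>k\<close> lies in \<open>V\<close>, the
  distance of \<open>z\<^sub>k\<^sub>+\<^sub>1\<close> from \<open>V\<close> is at most about \<open>q\<^sub>k\<^sub>+\<^sub>1 L\<^sub>k / q\<^sub>k\<close>, and by induction the first
  \<open>l + 1\<close> vectors span a volume bounded by the power \<open>1 - \<alpha> - \<dots> - \<alpha>\<^sup>l\<close> of the last
  denominator. For \<open>l = d + 1\<close> this exponent is negative, contradicting that the determinant
  is a nonzero integer.\<close>

section \<open>Determinants and integer vectors\<close>

text \<open>Vectors are functions read only at coordinates below \<open>n\<close>. Spans of initial
  segments are all that triangular elimination and greedy selection use; for \<open>l = 0\<close>
  the empty sum leaves only the zero vector.\<close>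

definition in_span :: "nat \<Rightarrow> (nat \<Rightarrow> nat \<Rightarrow> real) \<Rightarrow> nat \<Rightarrow> (nat \<Rightarrow> real) \<Rightarrow> bool" where
  "in_span n b l v \<longleftrightarrow> (\<exists>t. \<forall>j<n. v j = (\<Sum>i<l. t i * b i j))"

lemma in_span_cong:
  assumes "\<And>i. i < l \<Longrightarrow> b i = b' i"
  shows "in_span n b l v \<longleftrightarrow> in_span n b' l v"
  unfolding in_span_def using assms by simp

lemma in_span_base: "i < l \<Longrightarrow> in_span n b l (b i)"
  unfolding in_span_def
  by (rule exI[of _ "\<lambda>k. if k = i then 1 else 0"]) (simp add: sum.delta' if_distrib[of "\<lambda>x. x * _"] cong: if_cong)

lemma in_span_scale:
  assumes "in_span n b l v"
  shows "in_span n b l (\<lambda>j. c * v j)"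
proof -
  obtain t where "\<forall>j<n. v j = (\<Sum>i<l. t i * b i j)"
    using assms unfolding in_span_def by blast
  then show ?thesis
    unfolding in_span_def by (intro exI[of _ "\<lambda>i. c * t i"]) (simp add: sum_distrib_left mult.assoc)
qed

text \<open>Padding the \<open>l\<close> vectors with zero rows gives a singular square matrix, and
  over an integral domain such a matrix has a nonzero kernel vector with entries in that domain.
  Integral coefficients are what total irrationality can be applied to.\<close>

lemma integer_annihilator:
  fixes b :: "nat \<Rightarrow> nat \<Rightarrow> int"
  assumes "l < n"
  shows "\<exists>c. (\<exists>j<n. c j \<noteq> 0) \<and> (\<forall>i<l. (\<Sum>j<n. c j * b i j) = 0)"
proof -
  define A where "A = Matrix.mat n n (\<lambda>(i, j). if i < l then b i j else 0)"
  have A: "A \<in> carrier_mat n n"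
    by (simp add: A_def)
  have "Determinant.det A = 0"
    unfolding det_def'[OF A]
  proof (rule sum.neutral, safe)
    fix p assume "p permutes {0..<n}"
    then have "p l < n"
      using assms permutes_in_image[of p "{0..<n}" l] by simp
    then have "(\<Prod>i = 0..<n. A $$ (i, p i)) = 0"
      using assms by (intro prod_zero) (auto simp: A_def intro!: bexI[of _ l])
    then show "signof p * (\<Prod>i = 0..<n. A $$ (i, p i)) = 0"
      by simp
  qed
  then obtain v where v: "v \<in> carrier_vec n" "v \<noteq> 0\<^sub>v n" "A *\<^sub>v v = 0\<^sub>v n"
    using det_0_iff_vec_prod_zero[OF A] by blast
  have "\<exists>j<n. vec_index v j \<noteq> 0"
    using v(1,2) by (auto simp: vec_eq_iff)
  moreover have "(\<Sum>j<n. vec_index v j * b i j) = 0" if "i < l" for i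
  proof -
    have "i < n"
      using that assms by simp
    then have "vec_index (A *\<^sub>v v) i = (\<Sum>j<n. vec_index v j * b i j)"
      using v(1) that A
      by (auto simp: A_def scalar_prod_def atLeast0LessThan mult.commute intro!: sum.cong)
    then show ?thesis
      using v(3) \<open>i < n\<close> by simp
  qed
  ultimately show ?thesis
    by blast
qed

section \<open>Determinants of integer rows and their reductions\<close>

lemma abs_det_le:
  fixes A :: "real Matrix.mat"
  assumes A: "A \<in> carrier_mat n n"
    and le: "\<And>i j. i < n \<Longrightarrow> j < n \<Longrightarrow> \<bar>A $$ (i, j)\<bar> \<le> r i"
  shows "\<bar>Determinant.det A\<bar> \<le> fact n * (\<Prod>i<n. r i)"
proof -
  have "\<bar>Determinant.det A\<bar> \<le> (\<Sum>p | p permutes {0..<n}. \<bar>signof p * (\<Prod>i = 0..<n. A $$ (i, p i))\<bar>)"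
    unfolding det_def'[OF A] by (rule sum_abs)
  also have "\<dots> \<le> (\<Sum>p | p permutes {0..<n}. (\<Prod>i<n. r i))"
  proof (rule sum_mono, safe)
    fix p assume p: "p permutes {0..<n}"
    have "\<bar>\<Prod>i = 0..<n. A $$ (i, p i)\<bar> \<le> (\<Prod>i<n. r i)"
      unfolding abs_prod atLeast0LessThan
    proof (rule prod_mono)
      fix i assume "i \<in> {..<n}"
      then show "0 \<le> \<bar>A $$ (i, p i)\<bar> \<and> \<bar>A $$ (i, p i)\<bar> \<le> r i"
        using le[of i "p i"] permutes_in_image[OF p, of i] by simp
    qed
    then show "\<bar>signof p * (\<Prod>i = 0..<n. A $$ (i, p i))\<bar> \<le> (\<Prod>i<n. r i)"
      by (simp add: abs_mult sign_def)
  qed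
  also have "\<dots> = fact n * (\<Prod>i<n. r i)"
    using card_permutations[of "{0..<n}" n] by simp
  finally show ?thesis .
qed

text \<open>The passage from \<open>b\<close> to \<open>w\<close> is left multiplication by a lower
  triangular matrix with unit diagonal.\<close>

lemma det_row_reduction:
  fixes b w :: "nat \<Rightarrow> nat \<Rightarrow> real"
  assumes "\<And>i. i < n \<Longrightarrow> in_span n b i (\<lambda>j. w i j - b i j)"
  shows "Determinant.det (Matrix.mat n n (\<lambda>(i, j). w i j)) = Determinant.det (Matrix.mat n n (\<lambda>(i, j). b i j))"
proof -
  obtain t where t: "w i j - b i j = (\<Sum>k<i. t i k * b k j)" if "i < n" "j < n" for i j
    using assms unfolding in_span_def by metis
  define T where "T = Matrix.mat n n (\<lambda>(i, k). if k < i then t i k else if k = i then 1 else 0)"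
  define B where "B = Matrix.mat n n (\<lambda>(i, j). b i j)"
  have T: "T \<in> carrier_mat n n" and B: "B \<in> carrier_mat n n"
    by (simp_all add: T_def B_def)
  have "Matrix.mat n n (\<lambda>(i, j). w i j) = T * B"
  proof (rule eq_matI)
    fix i j assume ij: "i < dim_row (T * B)" "j < dim_col (T * B)"
    then have i: "i < n" and j: "j < n"
      by (simp_all add: T_def B_def)
    have "(T * B) $$ (i, j) = (\<Sum>k<n. (if k < i then t i k else if k = i then 1 else 0) * b k j)"
      using i j by (simp add: T_def B_def scalar_prod_def atLeast0LessThan)
    also have "\<dots> = (\<Sum>k<Suc i. (if k < i then t i k else if k = i then 1 else 0) * b k j)"
      using i by (intro sum.mono_neutral_right) auto
    also have "\<dots> = w i j"
      using t[OF i j] by simp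
    finally show "Matrix.mat n n (\<lambda>(i, j). w i j) $$ (i, j) = (T * B) $$ (i, j)"
      using i j by simp
  qed (simp_all add: T_def B_def)
  moreover have "Determinant.det T = 1"
    by (subst det_lower_triangular[OF _ T]) (auto simp: T_def prod_list_diag_prod)
  ultimately show ?thesis
    using det_mult[OF T B] by (simp add: B_def)
qed

text \<open>A vanishing determinant gives a nontrivial relation between the rows; solving it for the
  last row with nonzero coefficient puts that row in the span of the earlier ones.\<close>

lemma det_nonzero_if_independent:
  fixes b :: "nat \<Rightarrow> nat \<Rightarrow> real"
  assumes "\<And>i. i < n \<Longrightarrow> \<not> in_span n b i (b i)"
  shows "Determinant.det (Matrix.mat n n (\<lambda>(i, j). b i j)) \<noteq> 0"
proof
  define A where "A = Matrix.mat n n (\<lambda>(i, j). b j i)"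
  have A: "A \<in> carrier_mat n n"
    by (simp add: A_def)
  assume "Determinant.det (Matrix.mat n n (\<lambda>(i, j). b i j)) = 0"
  moreover have "transpose_mat A = Matrix.mat n n (\<lambda>(i, j). b i j)"
    by (rule eq_matI) (auto simp: A_def)
  ultimately have "Determinant.det A = 0"
    using det_transpose[OF A] by simp
  then obtain v where v: "v \<in> carrier_vec n" "v \<noteq> 0\<^sub>v n" "A *\<^sub>v v = 0\<^sub>v n"
    using det_0_iff_vec_prod_zero[OF A] by blast
  have rel: "(\<Sum>i<n. vec_index v i * b i j) = 0" if "j < n" for j
  proof -
    have "vec_index (A *\<^sub>v v) j = (\<Sum>i<n. vec_index v i * b i j)"
      using v(1) that A
      by (auto simp: A_def scalar_prod_def atLeast0LessThan mult.commute intro!: sum.cong)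
    then show ?thesis
      using v(3) that by simp
  qed
  define S where "S = {i. i < n \<and> vec_index v i \<noteq> 0}"
  have "finite S" "S \<noteq> {}"
    using v(1,2) by (auto simp: S_def vec_eq_iff)
  define k where "k = Max S"
  have k: "k < n" "vec_index v k \<noteq> 0"
    using Max_in[OF \<open>finite S\<close> \<open>S \<noteq> {}\<close>] by (simp_all add: k_def S_def)
  have above: "vec_index v i = 0" if "k < i" "i < n" for i
  proof (rule ccontr)
    assume "vec_index v i \<noteq> 0"
    then have "i \<le> k"
      using Max_ge[OF \<open>finite S\<close>, of i] that(2) by (simp add: k_def S_def)
    with that(1) show False
      by simp
  qed
  have "b k j = (\<Sum>i<k. - (vec_index v i / vec_index v k) * b i j)" if "j < n" for j
  proof -
    have "(\<Sum>i<n. vec_index v i * b i j) = (\<Sum>i<Suc k. vec_index v i * b i j)"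
      using k above by (intro sum.mono_neutral_right) auto
    then have "b k j = - (\<Sum>i<k. vec_index v i * b i j) / vec_index v k"
      using k(2) rel[OF that] by (simp add: field_simps)
    also have "\<dots> = (\<Sum>i<k. - (vec_index v i / vec_index v k) * b i j)"
      by (simp add: sum_divide_distrib sum_negf)
    finally show ?thesis .
  qed
  then have "in_span n b k (b k)"
    unfolding in_span_def by (intro exI[of _ "\<lambda>i. - (vec_index v i / vec_index v k)"]) simp
  with assms k(1) show False
    by blast
qed

text \<open>The rows \<open>b\<close> have a nonzero integer determinant, and reducing them to rows
  \<open>w\<close> with possibly much smaller entries does not change it.\<close>

lemma one_le_row_bounds:
  fixes b :: "nat \<Rightarrow> nat \<Rightarrow> int" and w :: "nat \<Rightarrow> nat \<Rightarrow> real"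
  defines "b' \<equiv> \<lambda>i j. of_int (b i j) :: real"
  assumes indep: "\<And>i. i < n \<Longrightarrow> \<not> in_span n b' i (b' i)"
    and red: "\<And>i. i < n \<Longrightarrow> in_span n b' i (\<lambda>j. w i j - b' i j)"
    and le: "\<And>i j. i < n \<Longrightarrow> j < n \<Longrightarrow> \<bar>w i j\<bar> \<le> r i"
  shows "1 \<le> fact n * (\<Prod>i<n. r i)"
proof -
  have "Matrix.mat n n (\<lambda>(i, j). b' i j) = map_mat of_int (Matrix.mat n n (\<lambda>(i, j). b i j))"
    by (rule eq_matI) (auto simp: b'_def)
  then have "Determinant.det (Matrix.mat n n (\<lambda>(i, j). b' i j))
    = of_int (Determinant.det (Matrix.mat n n (\<lambda>(i, j). b i j)))"
    by (simp add: of_int_hom.hom_det)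
  moreover have "Determinant.det (Matrix.mat n n (\<lambda>(i, j). b' i j)) \<noteq> 0"
    using indep by (rule det_nonzero_if_independent)
  ultimately have "1 \<le> \<bar>Determinant.det (Matrix.mat n n (\<lambda>(i, j). w i j))\<bar>"
    by (simp add: det_row_reduction[of n b' w, OF red])
  also have "\<dots> \<le> fact n * (\<Prod>i<n. r i)"
    using le by (intro abs_det_le) auto
  finally show ?thesis .
qed

text \<open>Each new index is the least one past the previous that leaves the current span, so
  minimality keeps its immediate predecessor inside. The hypothesis ranges over all \<open>m\<close>
  because the family is built during the induction.\<close>

lemma greedy_basis:
  fixes z :: "nat \<Rightarrow> nat \<Rightarrow> real" and i\<^sub>0 :: nat
  assumes "\<And>(m :: nat \<Rightarrow> nat) l i. l < n \<Longrightarrow> \<exists>k>i. \<not> in_span n (\<lambda>i. z (m i)) l (z k)"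
  shows "\<exists>m. m 0 = i\<^sub>0 \<and> (\<forall>l. Suc l < n \<longrightarrow> m l < m (Suc l)
    \<and> in_span n (\<lambda>i. z (m i)) (Suc l) (z (m (Suc l) - 1))
    \<and> \<not> in_span n (\<lambda>i. z (m i)) (Suc l) (z (m (Suc l))))"
proof -
  define P where "P = (\<lambda>m l. m l < m (Suc l)
    \<and> in_span n (\<lambda>i. z (m i)) (Suc l) (z (m (Suc l) - 1))
    \<and> \<not> in_span n (\<lambda>i. z (m i)) (Suc l) (z (m (Suc l))))"
  have "\<exists>m. m 0 = i\<^sub>0 \<and> (\<forall>l. Suc l < p \<longrightarrow> P m l)" if "p \<le> n" for p
    using that
  proof (induction p)
    case 0
    show ?case by (intro exI[of _ "\<lambda>_. i\<^sub>0"]) simp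
  next
    case (Suc p)
    then obtain m where m: "m 0 = i\<^sub>0" "\<And>l. Suc l < p \<Longrightarrow> P m l"
      by auto
    show ?case
    proof (cases p)
      case 0
      then show ?thesis using m by auto
    next
      case (Suc q)
      define k where "k = (LEAST k. m q < k \<and> \<not> in_span n (\<lambda>i. z (m i)) p (z k))"
      have k: "m q < k" "\<not> in_span n (\<lambda>i. z (m i)) p (z k)"
        using LeastI_ex[of "\<lambda>k. m q < k \<and> \<not> in_span n (\<lambda>i. z (m i)) p (z k)"]
          assms[of p "m q" m] \<open>Suc p \<le> n\<close>
        by (auto simp: k_def)
      have prev: "in_span n (\<lambda>i. z (m i)) p (z (k - 1))"
      proof (cases "k - 1 = m q")
        case True
        then show ?thesis
          using in_span_base[of q p n "\<lambda>i. z (m i)"] Suc by simp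
      next
        case False
        then have "m q < k - 1" "k - 1 < k"
          using k(1) by auto
        then show ?thesis
          using not_less_Least[of "k - 1" "\<lambda>k. m q < k \<and> \<not> in_span n (\<lambda>i. z (m i)) p (z k)"]
          by (auto simp: k_def)
      qed
      define m' where "m' = m(p := k)"
      have eq: "in_span n (\<lambda>i. z (m' i)) l v \<longleftrightarrow> in_span n (\<lambda>i. z (m i)) l v" if "l \<le> p" for l v
        using that by (intro in_span_cong) (simp add: m'_def)
      have "P m' l" if "Suc l < Suc p" for l
      proof (cases "l = q")
        case True
        then show ?thesis
          using Suc k prev eq[of p] by (simp add: P_def) (simp add: m'_def)
      next
        case False
        then have "Suc l < p"
          using that Suc by simp
        then show ?thesis
          using m(2)[of l] eq[of "Suc l"] by (simp add: P_def) (simp add: m'_def)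
      qed
      moreover have "m' 0 = i\<^sub>0"
        using m(1) Suc by (simp add: m'_def)
      ultimately show ?thesis
        by blast
    qed
  qed
  from this[of n] show ?thesis
    by (auto simp: P_def)
qed

section \<open>Growth of approximating sequences\<close>

text \<open>Otherwise a single integer form \<open>c\<close> vanishes at every \<open>z k\<close>
  with \<open>k > i\<close>. Dividing by \<open>z k 0\<close>, which tends to infinity while the
  errors stay bounded, gives an integer relation between 1 and the
  \<open>\<theta> j\<close>.\<close>

lemma independent_of_approximations:
  fixes \<theta> :: "nat \<Rightarrow> real" and z :: "nat \<Rightarrow> nat \<Rightarrow> int" and m :: "nat \<Rightarrow> nat"
  assumes irr: "totally_irrational n \<theta>"
    and X: "filterlim (\<lambda>k. real_of_int (z k 0)) at_top sequentially"
    and err: "\<And>k j. j \<in> {1..n} \<Longrightarrow> \<bar>of_int (z k j) - of_int (z k 0) * \<theta> j\<bar> \<le> B"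
    and l: "l < Suc n"
  shows "\<exists>k>i. \<not> in_span (Suc n) (\<lambda>i j. of_int (z (m i) j)) l (\<lambda>j. of_int (z k j))"
proof (rule ccontr)
  assume "\<not> ?thesis"
  then have span: "in_span (Suc n) (\<lambda>i j. of_int (z (m i) j)) l (\<lambda>j. of_int (z k j))" if "i < k" for k
    using that by blast
  obtain c where c: "\<exists>j<Suc n. c j \<noteq> 0" "\<And>i. i < l \<Longrightarrow> (\<Sum>j<Suc n. c j * z (m i) j) = 0"
    using integer_annihilator[OF l, of "\<lambda>i. z (m i)"] by blast
  have split: "{..<Suc n} = insert 0 {1..n}"
    by auto
  have zero: "(\<Sum>j<Suc n. of_int (c j) * real_of_int (z k j)) = 0" if k: "i < k" for k
  proof -
    obtain t where t: "\<And>j. j < Suc n \<Longrightarrow> real_of_int (z k j) = (\<Sum>i<l. t i * of_int (z (m i) j))"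
      using span[OF k] unfolding in_span_def by blast
    have "(\<Sum>j<Suc n. of_int (c j) * real_of_int (z k j))
      = (\<Sum>j<Suc n. \<Sum>i<l. t i * (of_int (c j) * of_int (z (m i) j)))"
      by (intro sum.cong refl) (simp add: t sum_distrib_left mult.left_commute)
    also have "\<dots> = (\<Sum>i<l. t i * (\<Sum>j<Suc n. of_int (c j) * of_int (z (m i) j)))"
      by (subst sum.swap) (simp only: sum_distrib_left)
    also have "\<dots> = (\<Sum>i<l. t i * of_int (\<Sum>j<Suc n. c j * z (m i) j))"
      by (simp only: of_int_sum of_int_mult)
    also have "\<dots> = 0"
      using c(2) by (intro sum.neutral) simp
    finally show ?thesis .
  qed
  \<comment> \<open>\<open>s\<close> is the form \<open>c\<close> at
    \<open>(1, \<theta> 1, ..., \<theta> n)\<close>. Where \<open>c\<close> kills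
    \<open>z k\<close>, the product \<open>s * z k 0\<close> is up to sign the value of
    \<open>c\<close> at the error vector, hence bounded by \<open>A\<close>.\<close>
  define s where "s = of_int (c 0) + (\<Sum>j = 1..n. of_int (c j) * \<theta> j)"
  define A where "A = (\<Sum>j = 1..n. \<bar>real_of_int (c j)\<bar> * B)"
  have bound: "\<bar>s\<bar> * of_int (z k 0) \<le> A" if k: "i < k" "z k 0 > 0" for k
  proof -
    have "- (s * of_int (z k 0))
      = (\<Sum>j<Suc n. of_int (c j) * real_of_int (z k j)) - s * of_int (z k 0)"
      using zero[OF k(1)] by simp
    also have "\<dots> = (\<Sum>j = 1..n. of_int (c j) * (of_int (z k j) - of_int (z k 0) * \<theta> j))"
      unfolding split s_def
      by (simp add: algebra_simps sum_subtractf sum_distrib_left)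
    finally have "\<bar>s * of_int (z k 0)\<bar>
      = \<bar>\<Sum>j = 1..n. of_int (c j) * (of_int (z k j) - of_int (z k 0) * \<theta> j)\<bar>"
      by (metis abs_minus_cancel)
    also have "\<dots> \<le> A"
      unfolding A_def using err
      by (intro order_trans[OF sum_abs] sum_mono) (auto simp: abs_mult intro!: mult_left_mono)
    finally show ?thesis
      using k(2) by (simp add: abs_mult)
  qed
  have "s = 0"
  proof (rule ccontr)
    assume "s \<noteq> 0"
    have "\<forall>\<^sub>F k in sequentially. max (A / \<bar>s\<bar>) 0 < real_of_int (z k 0) \<and> i < k"
      using X by (intro eventually_conj eventually_gt_at_top) (metis filterlim_at_top_dense)
    then obtain k where "max (A / \<bar>s\<bar>) 0 < real_of_int (z k 0)" "i < k"
      using eventually_happens'[OF sequentially_bot] by blast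
    then show False
      using bound[of k] \<open>s \<noteq> 0\<close> by (simp add: field_simps)
  qed
  then have "c 0 = 0" "\<forall>j\<in>{1..n}. c j = 0"
    using irr unfolding totally_irrational_def s_def by blast+
  then show False
    using c(1) split by (metis insertE lessThan_iff)
qed

text \<open>If the sum exceeded 1, the determinant of \<open>n + 1\<close> greedily chosen vectors
  would be at most a constant times a negative power of a denominator, which falls below 1 when the
  selection starts far out. Hypothesis \<open>below\<close> keeps the intermediate exponents in
  [0, 1].\<close>

lemma approximation_growth_bound:
  fixes \<theta> :: "nat \<Rightarrow> real" and z :: "nat \<Rightarrow> nat \<Rightarrow> int" and L :: "nat \<Rightarrow> real"
  defines "X \<equiv> \<lambda>k. real_of_int (z k 0)"
  assumes irr: "totally_irrational n \<theta>"
    and mono: "strict_mono X" and X0: "X 0 \<ge> 1"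
    and err: "\<And>k j. j \<in> {1..n} \<Longrightarrow> \<bar>of_int (z k j) - X k * \<theta> j\<bar> \<le> L k"
    and L: "decseq L" "\<And>k. 0 \<le> L k"
    and up: "\<And>k. k \<ge> k\<^sub>0 \<Longrightarrow> L k \<le> C * X (Suc k) powr - \<alpha>"
    and low: "\<And>k. k \<ge> k\<^sub>0 \<Longrightarrow> X (Suc k) powr \<alpha> \<le> C * X k"
    and \<alpha>: "0 < \<alpha>" and C: "1 \<le> C"
    and below: "\<And>l. l < n \<Longrightarrow> (\<Sum>k = 1..l. \<alpha> ^ k) \<le> 1"
  shows "(\<Sum>k = 1..n. \<alpha> ^ k) \<le> 1"
proof (rule ccontr)
  assume "\<not> ?thesis"
  then have above: "(\<Sum>k = 1..n. \<alpha> ^ k) > 1"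
    by simp
  \<comment> \<open>The first \<open>l + 1\<close> greedily chosen vectors will span a volume \<open>O(X powr \<sigma> l)\<close>.\<close>
  define \<sigma> where "\<sigma> = (\<lambda>l. 1 - (\<Sum>k = 1..l. \<alpha> ^ k))"
  have X_ge: "real k + 1 \<le> X k" for k
  proof (induction k)
    case (Suc k)
    have "z k 0 < z (Suc k) 0"
      using strict_monoD[OF mono, of k "Suc k"] by (simp add: X_def)
    with Suc show ?case
      by (simp add: X_def)
  qed (use X0 in simp)
  have X_pos: "X k > 0" for k
    using X_ge[of k] by simp
  have X_top: "filterlim X at_top sequentially"
    by (rule filterlim_at_top_mono[OF filterlim_real_sequentially])
       (use X_ge in \<open>auto intro!: always_eventually order_trans[OF _ X_ge]\<close>)
  have L_le: "L k \<le> L 0" for k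
    using L(1) by (simp add: decseqD)
  define M where "M = 1 + (\<Sum>j = 1..n. \<bar>\<theta> j\<bar>) + L 0"
  have M: "M \<ge> 1"
    using L(2)[of 0] by (simp add: M_def sum_nonneg)
  have entry: "\<bar>real_of_int (z k j)\<bar> \<le> M * X k" if "j < Suc n" for k j
  proof (cases "j = 0")
    case True
    then show ?thesis
      using M X_pos[of k] mult_right_mono[of 1 M "X k"] by (simp add: X_def)
  next
    case False
    then have j: "j \<in> {1..n}"
      using that by simp
    have "\<bar>real_of_int (z k j)\<bar> \<le> \<bar>X k * \<theta> j\<bar> + L 0"
      using err[OF j, of k] L_le[of k] by linarith
    also have "\<dots> \<le> X k * (\<Sum>j = 1..n. \<bar>\<theta> j\<bar>) + X k * L 0"
    proof (rule add_mono)
      show "\<bar>X k * \<theta> j\<bar> \<le> X k * (\<Sum>j = 1..n. \<bar>\<theta> j\<bar>)"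
        using X_pos[of k] member_le_sum[OF j, of "\<lambda>j. \<bar>\<theta> j\<bar>"]
        by (simp add: abs_mult mult_left_mono)
      show "L 0 \<le> X k * L 0"
        using X_ge[of k] L(2)[of 0] mult_right_mono[of 1 "X k" "L 0"] by simp
    qed
    also have "\<dots> \<le> M * X k"
      using X_pos[of k] by (simp add: M_def algebra_simps)
    finally show ?thesis .
  qed
  \<comment> \<open>Each selection step costs \<open>2 * C\<close> from the reduced row and a
    further \<open>C\<close> from \<open>low\<close>; the factor \<open>M\<close> covers the first
    row.\<close>
  define D where "D = 2 * C\<^sup>2 * M"
  have D: "D \<ge> 1"
  proof -
    have "1 * 1 \<le> C\<^sup>2 * M"
      using C M by (intro mult_mono) auto
    then show ?thesis
      by (simp add: D_def)
  qed
  have "1 \<le> fact (Suc n) * (D ^ Suc n * X i powr \<sigma> n)" if i: "i \<ge> k\<^sub>0" for i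
  proof -
    obtain m where m0: "m 0 = i" and m: "\<And>l. Suc l < Suc n \<Longrightarrow> m l < m (Suc l)
      \<and> in_span (Suc n) (\<lambda>i j. of_int (z (m i) j)) (Suc l) (\<lambda>j. of_int (z (m (Suc l) - 1) j))
      \<and> \<not> in_span (Suc n) (\<lambda>i j. of_int (z (m i) j)) (Suc l) (\<lambda>j. of_int (z (m (Suc l)) j))"
      using greedy_basis[of "Suc n" "\<lambda>k j. of_int (z k j)" i]
        independent_of_approximations[OF irr, of z "L 0", OF X_top[unfolded X_def]]
        order_trans[OF err L_le]
      unfolding X_def by auto
    have m_ge: "i \<le> m l" if "l \<le> n" for l
      using that
    proof (induction l)
      case (Suc l)
      then show ?case
        using m[of l] by simp
    qed (simp add: m0)
    \<comment> \<open>\<open>K l\<close> is the index just before the next chosen one, so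
      \<open>z (K l)\<close> still lies in the span of the first \<open>l + 1\<close> chosen
      vectors.\<close>
    define K where "K = (\<lambda>l. m (Suc l) - 1)"
    have K: "m (Suc l) = Suc (K l)" "m l \<le> K l" "k\<^sub>0 \<le> K l" if "l < n" for l
      using m[of l] m_ge[of l] that i by (auto simp: K_def)
    define b where "b = (\<lambda>l j. real_of_int (z (m l) j))"
    \<comment> \<open>The subtracted multiple of \<open>z (K l)\<close> matches the zeroth
      coordinate, which therefore vanishes. In the other coordinates the main terms
      \<open>X * \<theta> j\<close> cancel and only errors remain, bounded by
      \<open>r\<close>.\<close>
    define w where "w = (\<lambda>l j. case l of 0 \<Rightarrow> b 0 j
      | Suc l \<Rightarrow> b (Suc l) j - X (Suc (K l)) / X (K l) * real_of_int (z (K l) j))"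
    define r where "r = (\<lambda>l. case l of 0 \<Rightarrow> M * X i
      | Suc l \<Rightarrow> 2 * (X (Suc (K l)) / X (K l)) * L (K l))"
    have r_nonneg: "r l \<ge> 0" for l
      using X_pos L(2) M by (auto simp: r_def less_imp_le split: nat.split)
    have "1 \<le> fact (Suc n) * (\<Prod>l<Suc n. r l)"
    proof (rule one_le_row_bounds[of "Suc n" "\<lambda>l j. z (m l) j" w r])
      fix l assume l: "l < Suc n"
      show "\<not> in_span (Suc n) (\<lambda>i j. of_int (z (m i) j)) l (\<lambda>j. of_int (z (m l) j))"
      proof (cases l)
        case 0
        have "real_of_int (z (m 0) 0) \<noteq> 0"
          using X_pos[of "m 0"] by (simp add: X_def)
        then show ?thesis
          using 0 by (auto simp: in_span_def)
      next
        case (Suc k)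
        then show ?thesis
          using m[of k] l by simp
      qed
      show "in_span (Suc n) (\<lambda>i j. of_int (z (m i) j)) l (\<lambda>j. w l j - of_int (z (m l) j))"
      proof (cases l)
        case 0
        then show ?thesis
          by (simp add: in_span_def w_def b_def)
      next
        case (Suc k)
        then have "in_span (Suc n) (\<lambda>i j. of_int (z (m i) j)) l (\<lambda>j. of_int (z (K k) j))"
          using m[of k] l by (simp add: K_def)
        from in_span_scale[OF this, of "- (X (Suc (K k)) / X (K k))"] show ?thesis
          using Suc by (simp add: w_def b_def)
      qed
    next
      fix l j assume l: "l < Suc n" and j: "j < Suc n"
      show "\<bar>w l j\<bar> \<le> r l"
      proof (cases l)
        case 0
        then show ?thesis
          using entry[OF j, of i] by (simp add: w_def r_def b_def m0)
      next
        case (Suc k)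
        then have k: "k < n"
          using l by simp
        let ?K = "K k" and ?q = "X (Suc (K k)) / X (K k)"
        have q: "1 \<le> ?q"
          using strict_monoD[OF mono, of ?K "Suc ?K"] X_pos[of ?K] by simp
        have "\<bar>of_int (z (Suc ?K) j) - ?q * of_int (z ?K j)\<bar> \<le> 2 * ?q * L ?K"
        proof (cases "j = 0")
          case True
          then show ?thesis
            using X_pos[of ?K] q L(2)[of ?K] by (simp add: X_def)
        next
          case False
          then have j': "j \<in> {1..n}"
            using j by simp
          have "of_int (z (Suc ?K) j) - ?q * of_int (z ?K j)
            = (of_int (z (Suc ?K) j) - X (Suc ?K) * \<theta> j) - ?q * (of_int (z ?K j) - X ?K * \<theta> j)"
            using X_pos[of ?K] by (simp add: algebra_simps)
          also have "\<bar>\<dots>\<bar> \<le> \<bar>of_int (z (Suc ?K) j) - X (Suc ?K) * \<theta> j\<bar>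
              + ?q * \<bar>of_int (z ?K j) - X ?K * \<theta> j\<bar>"
            using X_pos[of ?K] X_pos[of "Suc ?K"]
            by (intro order_trans[OF abs_triangle_ineq4]) (simp add: abs_mult)
          also have "\<dots> \<le> L ?K + ?q * L ?K"
            using q err[OF j', of ?K] order_trans[OF err[OF j', of "Suc ?K"] decseq_SucD[OF L(1), of ?K]]
            by (intro add_mono mult_left_mono) auto
          also have "\<dots> \<le> ?q * L ?K + ?q * L ?K"
            by (intro add_right_mono) (use mult_right_mono[OF q L(2)[of ?K]] in simp)
          also have "\<dots> = 2 * ?q * L ?K"
            by (simp only: mult_2 distrib_right)
          finally show ?thesis .
        qed
        then show ?thesis
          using Suc K(1)[OF k] by (simp add: w_def r_def b_def)
      qed
    qed
    moreover have "(\<Prod>l<Suc l. r l) \<le> D ^ Suc l * X (m l) powr \<sigma> l" if "l \<le> n" for l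
      using that
    proof (induction l)
      case 0
      have "M \<le> D"
        using M mult_right_mono[of 1 "2 * C\<^sup>2" M] one_le_power[OF C, of 2] by (simp add: D_def)
      then show ?case
        using X_pos[of i] by (simp add: r_def \<sigma>_def m0)
    next
      case (Suc l)
      let ?K = "K l" and ?Y = "X (Suc (K l))"
      let ?e = "1 - \<sigma> l"
      have l: "l < n"
        using Suc.prems by simp
      have e: "0 \<le> ?e" "?e \<le> 1"
        using below[OF l] \<alpha> by (auto simp: \<sigma>_def intro!: sum_nonneg)
      \<comment> \<open>As \<open>?e \<ge> 0\<close>, the lower bound \<open>low\<close> for
        \<open>X ?K\<close> turns into an upper bound for its negative power;
        \<open>?e \<le> 1\<close> reduces \<open>C powr ?e\<close> to \<open>C\<close>.\<close>
      have step: "X ?K powr - ?e \<le> C * ?Y powr (- \<alpha> * ?e)"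
      proof -
        have powr: "(?Y powr \<alpha> / C) powr - e = C powr e * ?Y powr (- \<alpha> * e)" for e
          using C X_pos[of "Suc ?K"] by (simp add: powr_divide powr_powr powr_minus field_simps)
        have "?Y powr \<alpha> / C \<le> X ?K"
          using low[OF K(3)[OF l]] C by (simp add: field_simps)
        then have "X ?K powr - ?e \<le> (?Y powr \<alpha> / C) powr - ?e"
          using e(1) X_pos[of "Suc ?K"] C by (intro powr_mono2') auto
        also have "\<dots> = C powr ?e * ?Y powr (- \<alpha> * ?e)"
          by (rule powr)
        also have "\<dots> \<le> C * ?Y powr (- \<alpha> * ?e)"
          using powr_mono[OF e(2) C] C by (intro mult_right_mono) auto
        finally show ?thesis .
      qed
      \<comment> \<open>Horner's rule: the sum up to \<open>Suc l\<close> is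
        \<open>\<alpha> * (1 + ?e)\<close>.\<close>
      have \<sigma>: "\<sigma> (Suc l) = 1 - \<alpha> - \<alpha> * ?e"
      proof -
        have "(\<Sum>k = 1..Suc l. \<alpha> ^ k) = \<alpha> + (\<Sum>k = 1..l. \<alpha> ^ Suc k)"
          by (subst sum.atLeast_Suc_atMost) (simp_all add: sum.shift_bounds_cl_Suc_ivl del: sum.cl_ivl_Suc)
        then show ?thesis
          by (simp add: \<sigma>_def sum_distrib_left)
      qed
      have "(\<Prod>l<Suc (Suc l). r l) = (\<Prod>l<Suc l. r l) * r (Suc l)"
        by simp
      also have "\<dots> \<le> (D ^ Suc l * X ?K powr \<sigma> l) * (2 * (?Y / X ?K) * (C * ?Y powr - \<alpha>))"
      proof (rule mult_mono)
        have "X (m l) powr \<sigma> l \<le> X ?K powr \<sigma> l"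
          using X_pos[of "m l"] e(2) strict_mono_mono[OF mono] K(2)[OF l]
          by (intro powr_mono2) (auto simp: monoD)
        then show "(\<Prod>l<Suc l. r l) \<le> D ^ Suc l * X ?K powr \<sigma> l"
          using Suc l D by (intro order_trans[OF Suc.IH] mult_left_mono) auto
        show "r (Suc l) \<le> 2 * (?Y / X ?K) * (C * ?Y powr - \<alpha>)"
          unfolding r_def using up[OF K(3)[OF l]] X_pos[of ?K] X_pos[of "Suc ?K"]
          by (simp del: times_divide_eq_right times_divide_eq_left add: mult_left_mono)
        show "0 \<le> D ^ Suc l * X ?K powr \<sigma> l"
          using D by simp
        show "0 \<le> r (Suc l)"
          by (rule r_nonneg)
      qed
      also have "\<dots> = D ^ Suc l * (2 * C) * (?Y powr (1 - \<alpha>)) * (X ?K powr - ?e)"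
        using X_pos[of ?K] X_pos[of "Suc ?K"]
        by (simp add: powr_diff powr_minus field_simps)
      also have "\<dots> \<le> D ^ Suc l * (2 * C) * (?Y powr (1 - \<alpha>)) * (C * ?Y powr (- \<alpha> * ?e))"
        using step D C by (intro mult_left_mono) auto
      also have "\<dots> = D ^ Suc l * (2 * C\<^sup>2) * ?Y powr \<sigma> (Suc l)"
        by (simp add: \<sigma> power2_eq_square powr_add[symmetric] algebra_simps)
      also have "\<dots> \<le> D ^ Suc l * D * ?Y powr \<sigma> (Suc l)"
        using D C M mult_left_mono[of 1 M "2 * C\<^sup>2"]
        by (intro mult_right_mono mult_left_mono) (auto simp: D_def)
      finally show ?case
        using K(1)[OF l] by (simp add: mult_ac)
    qed
    ultimately have "1 \<le> fact (Suc n) * (D ^ Suc n * X (m n) powr \<sigma> n)"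
      by (meson fact_ge_zero le_refl mult_left_mono order_trans)
    \<comment> \<open>The exponent \<open>\<sigma> n\<close> is negative, so the unknown last
      denominator may be replaced by the smaller \<open>X i\<close>, and \<open>i\<close> is free to
      tend to infinity.\<close>
    also have "X (m n) powr \<sigma> n \<le> X i powr \<sigma> n"
      using above X_pos[of i] m_ge[of n] strict_mono_mono[OF mono]
      by (intro powr_mono2') (auto simp: \<sigma>_def monoD)
    finally show ?thesis
      using D by (simp add: mult_left_mono)
  qed
  then have "\<forall>\<^sub>F i in sequentially. 1 \<le> fact (Suc n) * (D ^ Suc n * X i powr \<sigma> n)"
    by (auto simp: eventually_sequentially)
  moreover have "(\<lambda>i. fact (Suc n) * (D ^ Suc n * X i powr \<sigma> n)) \<longlonglongrightarrow> fact (Suc n) * (D ^ Suc n * 0)"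
    using above by (intro tendsto_intros tendsto_neg_powr X_top) (simp add: \<sigma>_def)
  ultimately have "1 \<le> fact (Suc n) * (D ^ Suc n * 0)"
    using tendsto_lowerbound[OF _ _ sequentially_bot] by blast
  then show False
    by simp
qed

section \<open>Best approximations and the uniform exponent\<close>

text \<open>\<open>X\<close> enumerates the strict records of \<open>L\<close>, the indices with a
  smaller value than all earlier ones. Positivity and arbitrarily small values make them infinite in
  number.\<close>

lemma best_approximation_sequence:
  fixes L :: "nat \<Rightarrow> real"
  assumes pos: "\<And>q. 1 \<le> q \<Longrightarrow> 0 < L q"
    and small: "\<And>e. 0 < e \<Longrightarrow> \<exists>q\<ge>1. L q < e"
  obtains X :: "nat \<Rightarrow> nat" where "strict_mono X" "\<And>k. 1 \<le> X k"
    "\<And>k q. 1 \<le> q \<Longrightarrow> q < X k \<Longrightarrow> L (X k) < L q"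
    "\<And>k q. 1 \<le> q \<Longrightarrow> q < X (Suc k) \<Longrightarrow> L (X k) \<le> L q"
proof -
  define S where "S = {q. 1 \<le> q \<and> (\<forall>q'. 1 \<le> q' \<and> q' < q \<longrightarrow> L q < L q')}"
  have "\<exists>q\<in>S. N < q" for N
  proof -
    \<comment> \<open>An index with a value below this minimum must exceed \<open>N\<close>; the
      range ends at \<open>Suc N\<close> so that it is nonempty even for
      \<open>N = 0\<close>.\<close>
    define e where "e = Min (L ` {1..Suc N})"
    have e: "0 < e" "\<And>q. q \<in> {1..Suc N} \<Longrightarrow> e \<le> L q"
      using pos by (auto simp: e_def)
    define q where "q = (LEAST q. 1 \<le> q \<and> L q < e)"
    have q: "1 \<le> q" "L q < e"
      using LeastI_ex[of "\<lambda>q. 1 \<le> q \<and> L q < e"] small[OF e(1)] by (auto simp: q_def)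
    have "L q < L q'" if "1 \<le> q'" "q' < q" for q'
      using not_less_Least[of q' "\<lambda>q. 1 \<le> q \<and> L q < e"] that q(2) by (auto simp: q_def)
    moreover have "N < q"
      using e(2)[of q] q by (cases "q \<le> Suc N") auto
    ultimately show ?thesis
      using q(1) by (intro bexI[of _ q]) (simp_all add: S_def)
  qed
  then have inf: "infinite S"
    unfolding infinite_nat_iff_unbounded by blast
  define X where "X = enumerate S"
  have X: "X k \<in> S" for k
    using enumerate_in_set[OF inf] by (simp add: X_def)
  have mono: "strict_mono X"
    using inf by (simp add: X_def strict_mono_enumerate)
  have "L (X k) \<le> L q" if q: "1 \<le> q" "q < X (Suc k)" for k q
  proof -
    \<comment> \<open>The first index with a value at most \<open>L q\<close> is itself a record,
      hence some \<open>X i\<close> with \<open>i \<le> k\<close>.\<close>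
    define p where "p = (LEAST p. 1 \<le> p \<and> L p \<le> L q)"
    have p: "1 \<le> p" "L p \<le> L q" "p \<le> q"
      using LeastI[of "\<lambda>p. 1 \<le> p \<and> L p \<le> L q" q] Least_le[of "\<lambda>p. 1 \<le> p \<and> L p \<le> L q" q] q(1)
      by (auto simp: p_def)
    have "L p < L q'" if "1 \<le> q'" "q' < p" for q'
      using not_less_Least[of q' "\<lambda>p. 1 \<le> p \<and> L p \<le> L q"] that p(2) by (auto simp: p_def)
    then have "p \<in> S"
      using p(1) by (simp add: S_def)
    then obtain i where i: "X i = p"
      using enumerate_Ex[OF inf, of p] by (auto simp: X_def)
    have "i < Suc k"
      using i p(3) q(2) mono by (metis le_less_trans strict_mono_less)
    show ?thesis
    proof (cases "i = k")
      case True
      then show ?thesis using i p(2) by simp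
    next
      case False
      then have "X i < X k"
        using \<open>i < Suc k\<close> mono by (simp add: strict_mono_less)
      then have "L (X k) < L (X i)"
        using X[of k] X[of i] by (simp add: S_def)
      then show ?thesis using i p(2) by simp
    qed
  qed
  then show thesis
    using that[of X] mono X by (auto simp: S_def)
qed

text \<open>For \<open>n \<ge> 1\<close> this is the sup-norm distance of
  \<open>q * \<theta>\<close> from the integer lattice: nearest integers are optimal in each
  coordinate separately.\<close>

definition approx_error :: "nat \<Rightarrow> (nat \<Rightarrow> real) \<Rightarrow> nat \<Rightarrow> real" where
  "approx_error n \<theta> q = (MAX j\<in>{1..n}. \<bar>real q * \<theta> j - of_int (round (real q * \<theta> j))\<bar>)"

lemma approx_error_ge:
  "j \<in> {1..n} \<Longrightarrow> \<bar>real q * \<theta> j - of_int (round (real q * \<theta> j))\<bar> \<le> approx_error n \<theta> q"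
  unfolding approx_error_def by (intro Max_ge) auto

lemma approx_error_attained:
  assumes "1 \<le> n"
  obtains j where "j \<in> {1..n}"
    "approx_error n \<theta> q = \<bar>real q * \<theta> j - of_int (round (real q * \<theta> j))\<bar>"
proof -
  have "approx_error n \<theta> q \<in> (\<lambda>j. \<bar>real q * \<theta> j - of_int (round (real q * \<theta> j))\<bar>) ` {1..n}"
    unfolding approx_error_def using assms by (intro Max_in) auto
  then show thesis
    using that by blast
qed

lemma approx_error_le:
  assumes "1 \<le> n" "\<And>j. j \<in> {1..n} \<Longrightarrow> \<bar>real q * \<theta> j - of_int (a j)\<bar> \<le> e"
  shows "approx_error n \<theta> q \<le> e"
proof -
  obtain j where j: "j \<in> {1..n}"
    "approx_error n \<theta> q = \<bar>real q * \<theta> j - of_int (round (real q * \<theta> j))\<bar>"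
    using approx_error_attained[OF assms(1)] .
  then show ?thesis
    using round_diff_minimal[of "real q * \<theta> j" "a j"] assms(2)[OF j(1)] by simp
qed

lemma approx_error_pos:
  assumes irr: "totally_irrational n \<theta>" and n: "1 \<le> n" and q: "1 \<le> q"
  shows "0 < approx_error n \<theta> q"
proof -
  have "real q * \<theta> 1 \<noteq> of_int a" for a
  proof
    assume "real q * \<theta> 1 = of_int a"
    moreover have "(\<Sum>j = 1..n. of_int (if j = 1 then int q else 0) * \<theta> j) = real q * \<theta> 1"
      using n by (simp add: if_distrib[of "\<lambda>x. x * _"] sum.delta' if_distrib[of of_int] cong: if_cong)
    ultimately have "of_int (- a) + (\<Sum>j = 1..n. of_int (if j = 1 then int q else 0) * \<theta> j) = 0"
      by simp
    then have "\<forall>j\<in>{1..n}. (if j = 1 then int q else 0) = 0"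
      using irr[unfolded totally_irrational_def, rule_format, of "- a" "\<lambda>j. if j = 1 then int q else 0"]
      by blast
    from bspec[OF this, of 1] show False
      using n q by simp
  qed
  then have "0 < \<bar>real q * \<theta> 1 - of_int (round (real q * \<theta> 1))\<bar>"
    by simp
  also have "\<dots> \<le> approx_error n \<theta> q"
    using n by (intro approx_error_ge) simp
  finally show ?thesis .
qed

text \<open>Some admissible \<open>\<gamma>\<close> exceeds \<open>\<alpha>\<close>, and for
  \<open>Q \<ge> 1\<close> the bound with \<open>\<gamma>\<close> implies the one with
  \<open>\<alpha>\<close>.\<close>

lemma uniform_exponent_gtD:
  assumes n: "1 \<le> n" and "ereal \<alpha> < uniform_exponent n \<theta>"
  obtains Q\<^sub>0 where "\<And>Q. Q\<^sub>0 \<le> Q \<Longrightarrow> \<exists>q\<ge>1. real q \<le> Q \<and> approx_error n \<theta> q < Q powr - \<alpha>"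
proof -
  obtain \<gamma> where \<gamma>: "\<alpha> < \<gamma>" and "\<forall>\<^sub>F Q in at_top. \<exists>(q :: int) (a :: nat \<Rightarrow> int).
       1 \<le> q \<and> of_int q \<le> Q \<and> (MAX j\<in>{1..n}. \<bar>of_int q * \<theta> j - of_int (a j)\<bar>) < Q powr (- \<gamma>)"
    using assms(2) unfolding uniform_exponent_def less_Sup_iff by auto
  then obtain Q\<^sub>1 where Q\<^sub>1: "\<And>Q. Q\<^sub>1 \<le> Q \<Longrightarrow> \<exists>(q :: int) (a :: nat \<Rightarrow> int).
       1 \<le> q \<and> of_int q \<le> Q \<and> (MAX j\<in>{1..n}. \<bar>of_int q * \<theta> j - of_int (a j)\<bar>) < Q powr (- \<gamma>)"
    unfolding eventually_at_top_linorder by blast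
  have "\<exists>q\<ge>1. real q \<le> Q \<and> approx_error n \<theta> q < Q powr - \<alpha>" if "max 1 Q\<^sub>1 \<le> Q" for Q
  proof -
    have "Q\<^sub>1 \<le> Q"
      using that by simp
    then obtain q :: int and a :: "nat \<Rightarrow> int" where qa: "1 \<le> q" "of_int q \<le> Q"
      "(MAX j\<in>{1..n}. \<bar>of_int q * \<theta> j - of_int (a j)\<bar>) < Q powr (- \<gamma>)"
      using Q\<^sub>1 by blast
    have "approx_error n \<theta> (nat q) \<le> (MAX j\<in>{1..n}. \<bar>of_int q * \<theta> j - of_int (a j)\<bar>)"
      using qa(1) by (intro approx_error_le[OF n, of _ _ a] Max_ge) auto
    also note qa(3)
    also have "Q powr - \<gamma> \<le> Q powr - \<alpha>"
      using \<gamma> that by (intro powr_mono) auto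
    finally show ?thesis
      using qa(1,2) by (intro exI[of _ "nat q"]) auto
  qed
  then show thesis
    using that by blast
qed

section \<open>The paraboloid\<close>

text \<open>The right side consists of squares of 2 x 2 minors of a primitive isotropic vector and a
  vector not proportional to it. Modulo \<open>q\<close>, the sum over \<open>I\<close> is
  \<open>q'^2\<close> times the sum of the squares of the \<open>a i\<close>, a multiple of
  \<open>q\<close>; so it is at least \<open>q\<close> unless it vanishes. In that case
  \<open>q\<close> divides the square of the last minor.\<close>

lemma isotropic_separation:
  fixes q q' b b' :: int and a a' :: "'i \<Rightarrow> int"
  assumes "finite I" and q: "0 < q"
    and iso: "(\<Sum>i\<in>I. (a i)\<^sup>2) = q * b"
    and prim: "\<And>g. g dvd q \<Longrightarrow> (\<And>i. i \<in> I \<Longrightarrow> g dvd a i) \<Longrightarrow> g dvd b \<Longrightarrow> is_unit g"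
    and indep: "(\<exists>i\<in>I. q' * a i \<noteq> q * a' i) \<or> q' * b \<noteq> q * b'"
  shows "q \<le> (\<Sum>i\<in>I. (q' * a i - q * a' i)\<^sup>2) + (q' * b - q * b')\<^sup>2"
proof (cases "\<exists>i\<in>I. q' * a i \<noteq> q * a' i")
  case True
  have "(\<Sum>i\<in>I. (q' * a i - q * a' i)\<^sup>2)
    = (\<Sum>i\<in>I. q'\<^sup>2 * (a i)\<^sup>2 + q * (q * (a' i)\<^sup>2 - 2 * q' * a i * a' i))"
    by (intro sum.cong refl) (simp add: power2_eq_square algebra_simps)
  also have "\<dots> = q'\<^sup>2 * (q * b) + q * (\<Sum>i\<in>I. q * (a' i)\<^sup>2 - 2 * q' * a i * a' i)"
    by (simp add: sum.distrib sum_distrib_left[symmetric] iso)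
  finally have "q dvd (\<Sum>i\<in>I. (q' * a i - q * a' i)\<^sup>2)"
    by simp
  moreover have "0 < (\<Sum>i\<in>I. (q' * a i - q * a' i)\<^sup>2)"
    using True \<open>finite I\<close> by (auto intro!: sum_pos2)
  ultimately have "q \<le> (\<Sum>i\<in>I. (q' * a i - q * a' i)\<^sup>2)"
    by (rule zdvd_imp_le)
  then show ?thesis
    by (simp add: add_increasing2)
next
  case False
  define E where "E = q' * b - q * b'"
  have "E \<noteq> 0"
    using False indep by (simp add: E_def)
  define c where "c = Gcd (insert q (a ` I))"
  have cq: "c dvd q"
    unfolding c_def by (rule Gcd_dvd) simp
  have ca: "c dvd a i" if "i \<in> I" for i
    unfolding c_def using that by (intro Gcd_dvd) simp
  obtain s where s: "q = c * s"
    using cq by (elim dvdE)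
  have c0: "c \<noteq> 0"
    using q s by auto
  \<comment> \<open>Since \<open>q' * a i = q * a' i\<close>, \<open>q\<close> divides
    \<open>q'\<close> times each of the numbers with gcd \<open>c\<close>, hence
    \<open>q' * c\<close>; cancelling \<open>c\<close> leaves \<open>s dvd q'\<close>.\<close>
  have "q dvd Gcd ((*) q' ` insert q (a ` I))"
    using False by (intro Gcd_greatest) auto
  then have "q dvd q' * c"
    unfolding c_def by (simp only: Gcd_mult dvd_normalize_iff)
  then have "c * s dvd c * q'"
    by (simp only: s mult.commute)
  then have "s dvd q'"
    using c0 by simp
  then have sE: "s dvd E"
    by (simp add: E_def s)
  \<comment> \<open>The sum of squares equals \<open>c * s * b\<close>, so \<open>c\<close> divides
    \<open>s * b\<close>. Primitivity makes \<open>c\<close> coprime to \<open>b\<close>, hence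
    \<open>c dvd s\<close>; then \<open>c\<close> and \<open>s\<close> both divide \<open>E\<close>,
    and \<open>q = c * s\<close> divides its square.\<close>
  have "c * c dvd (\<Sum>i\<in>I. (a i)\<^sup>2)"
    using ca by (intro dvd_sum) (simp add: power2_eq_square mult_dvd_mono)
  then have "c * c dvd c * (s * b)"
    by (simp add: iso s mult.assoc)
  then have "c dvd s * b"
    using c0 by simp
  moreover have "coprime c b"
  proof (rule coprimeI)
    fix g assume g: "g dvd c" "g dvd b"
    show "is_unit g"
      using g cq ca by (intro prim) (blast intro: dvd_trans)+
  qed
  ultimately have "c dvd s"
    by (simp add: coprime_dvd_mult_left_iff)
  then have "q dvd E\<^sup>2"
    using sE unfolding s power2_eq_square by (intro mult_dvd_mono) (auto intro: dvd_trans)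
  moreover have "0 < E\<^sup>2"
    using \<open>E \<noteq> 0\<close> by simp
  ultimately have "q \<le> E\<^sup>2"
    by (rule zdvd_imp_le)
  then show ?thesis
    by (simp add: E_def add_increasing sum_nonneg)
qed

section \<open>The root \<open>H d\<close> and exponents just above it\<close>

lemma H_root: "0 < H d" "(\<Sum>k = 1..d + 1. H d ^ k) = 1"
  using theI'[OF ex1_positive_root[of d]] by (simp_all add: H_def)

lemma half_less_H: "1 / 2 < H d"
proof (rule ccontr)
  assume "\<not> 1 / 2 < H d"
  then have "1 \<le> (\<Sum>k = 1..d + 1. (1 / 2 :: real) ^ k)"
    unfolding H_root(2)[of d, symmetric] using H_root(1)[of d] by (intro sum_mono power_mono) auto
  also have "\<dots> = 1 - (1 / 2) ^ (d + 1)"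
    by (induction d) (auto simp: field_simps)
  finally show False
    using zero_less_power[of "1 / 2 :: real" "d + 1"] by linarith
qed

text \<open>At \<open>H d\<close> the sum up to \<open>d\<close> is below 1 and stays so slightly to
  the right by continuity, while the sum up to \<open>d + 1\<close> already exceeds 1 there. The
  case \<open>l = 1\<close> gives \<open>\<alpha> \<le> 1\<close>.\<close>

lemma exponent_above_H:
  assumes "d \<ge> 1" "H d < \<gamma>"
  obtains \<alpha> where "H d < \<alpha>" "\<alpha> < \<gamma>" "\<alpha> \<le> 1"
    "\<And>l. l < d + 1 \<Longrightarrow> (\<Sum>k = 1..l. \<alpha> ^ k) \<le> 1" "1 < (\<Sum>k = 1..d + 1. \<alpha> ^ k)"
proof -
  have "(\<Sum>k = 1..d + 1. H d ^ k) = (\<Sum>k = 1..d. H d ^ k) + H d ^ (d + 1)"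
    by simp
  then have "(\<Sum>k = 1..d. H d ^ k) < 1"
    using H_root(2)[of d] zero_less_power[OF H_root(1)[of d], of "d + 1"] by linarith
  moreover have "((\<lambda>x. \<Sum>k = 1..d. x ^ k) \<longlongrightarrow> (\<Sum>k = 1..d. H d ^ k)) (at_right (H d))"
    by (intro tendsto_intros)
  ultimately have "\<forall>\<^sub>F x in at_right (H d). (\<Sum>k = 1..d. x ^ k) < 1 \<and> x < \<gamma> \<and> H d < x"
    using assms(2)
    by (intro eventually_conj eventually_at_right_less order_tendstoD(2))
       (auto simp: eventually_at_right)
  then obtain \<alpha> where \<alpha>: "(\<Sum>k = 1..d. \<alpha> ^ k) < 1" "\<alpha> < \<gamma>" "H d < \<alpha>"
    using eventually_happens'[OF trivial_limit_at_right_real] by blast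
  have pos: "0 < \<alpha>"
    using \<alpha>(3) H_root(1)[of d] by simp
  have below: "(\<Sum>k = 1..l. \<alpha> ^ k) \<le> 1" if "l < d + 1" for l
  proof -
    have "(\<Sum>k = 1..l. \<alpha> ^ k) \<le> (\<Sum>k = 1..d. \<alpha> ^ k)"
      using that pos by (intro sum_mono2) auto
    then show ?thesis
      using \<alpha>(1) by simp
  qed
  have "(\<Sum>k = 1..d + 1. H d ^ k) < (\<Sum>k = 1..d + 1. \<alpha> ^ k)"
    using H_root(1)[of d] \<alpha>(3) by (intro sum_strict_mono power_strict_mono) auto
  then show thesis
    using that[of \<alpha>] \<alpha> below below[of 1] assms(1) H_root(2)[of d] by simp
qed

text \<open>On the paraboloid the terms of order \<open>q^2\<close> cancel. What remains is linear
  in the errors with a factor \<open>q\<close>, plus their squares, which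
  \<open>L \<le> L\<^sub>0\<close> and \<open>1 \<le> q\<close> reduce to
  \<open>q * L * L\<^sub>0\<close>.\<close>

lemma paraboloid_form_bound:
  fixes \<xi> e :: "nat \<Rightarrow> real"
  assumes "1 \<le> q" "0 \<le> L" "L \<le> L\<^sub>0" and e: "\<And>i. i \<in> {1..d} \<Longrightarrow> \<bar>e i\<bar> \<le> L" "\<bar>e'\<bar> \<le> L"
  shows "\<bar>(\<Sum>i = 1..d. (q * \<xi> i + e i)\<^sup>2) - q * (q * (\<Sum>i = 1..d. (\<xi> i)\<^sup>2) + e')\<bar>
    \<le> (2 * (\<Sum>i = 1..d. \<bar>\<xi> i\<bar>) + real d * L\<^sub>0 + 1) * (q * L)"
proof -
  have "(\<Sum>i = 1..d. (q * \<xi> i + e i)\<^sup>2) - q * (q * (\<Sum>i = 1..d. (\<xi> i)\<^sup>2) + e')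
    = (\<Sum>i = 1..d. 2 * q * \<xi> i * e i + e i * e i) - q * e'"
    by (simp add: power2_eq_square algebra_simps sum.distrib sum_distrib_left)
  also have "\<bar>\<dots>\<bar> \<le> \<bar>\<Sum>i = 1..d. 2 * q * \<xi> i * e i + e i * e i\<bar> + \<bar>q * e'\<bar>"
    by (rule abs_triangle_ineq4)
  also have "\<dots> \<le> (\<Sum>i = 1..d. 2 * q * \<bar>\<xi> i\<bar> * L + q * L * L\<^sub>0) + q * L"
  proof (rule add_mono)
    show "\<bar>\<Sum>i = 1..d. 2 * q * \<xi> i * e i + e i * e i\<bar> \<le> (\<Sum>i = 1..d. 2 * q * \<bar>\<xi> i\<bar> * L + q * L * L\<^sub>0)"
    proof (rule order_trans[OF sum_abs], rule sum_mono)
      fix i assume i: "i \<in> {1..d}"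
      have "\<bar>e i\<bar> * \<bar>e i\<bar> \<le> L * L\<^sub>0"
        using e(1)[OF i] assms by (intro mult_mono) auto
      also have "\<dots> \<le> q * (L * L\<^sub>0)"
        using mult_right_mono[OF assms(1), of "L * L\<^sub>0"] assms by simp
      finally have "\<bar>e i * e i\<bar> \<le> q * L * L\<^sub>0"
        by (simp add: abs_mult mult.assoc)
      moreover have "\<bar>2 * q * \<xi> i * e i\<bar> \<le> 2 * q * \<bar>\<xi> i\<bar> * L"
        using e(1)[OF i] assms(1) by (simp add: abs_mult mult_left_mono)
      ultimately show "\<bar>2 * q * \<xi> i * e i + e i * e i\<bar> \<le> 2 * q * \<bar>\<xi> i\<bar> * L + q * L * L\<^sub>0"
        by linarith
    qed
    show "\<bar>q * e'\<bar> \<le> q * L"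
      using e(2) assms(1) by (simp add: abs_mult)
  qed
  also have "\<dots> = (2 * (\<Sum>i = 1..d. \<bar>\<xi> i\<bar>) + real d * L\<^sub>0 + 1) * (q * L)"
    by (simp add: sum.distrib sum_distrib_left sum_distrib_right algebra_simps)
  finally show ?thesis .
qed

theorem theorem1:
  fixes d :: nat and \<xi> :: "nat \<Rightarrow> real"
  assumes "d \<ge> 1"
    and "totally_irrational (d + 1) (paraboloid_point d \<xi>)"
  shows "uniform_exponent (d + 1) (paraboloid_point d \<xi>) \<le> ereal (H d)"
proof (rule ccontr)
  define \<theta> where "\<theta> = paraboloid_point d \<xi>"
  define n where "n = d + 1"
  have n: "1 \<le> n"
    by (simp add: n_def)
  have irr: "totally_irrational n \<theta>"
    using assms(2) by (simp add: n_def \<theta>_def)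
  assume "\<not> ?thesis"
  then have "ereal (H d) < uniform_exponent n \<theta>"
    by (simp add: n_def \<theta>_def)
  then obtain \<gamma> where \<gamma>: "H d < \<gamma>" "ereal \<gamma> < uniform_exponent n \<theta>"
    using ereal_dense2 by (metis ereal_less_eq(3) less_ereal.simps(1))
  obtain \<alpha> where \<alpha>: "H d < \<alpha>" "\<alpha> < \<gamma>" "\<alpha> \<le> 1"
    and below: "\<And>l. l < n \<Longrightarrow> (\<Sum>k = 1..l. \<alpha> ^ k) \<le> 1" and above: "1 < (\<Sum>k = 1..n. \<alpha> ^ k)"
    using exponent_above_H[OF assms(1) \<gamma>(1)] unfolding n_def by metis
  have half: "1 / 2 < \<alpha>"
    using half_less_H[of d] \<alpha>(1) by simp
  have "ereal \<alpha> < uniform_exponent n \<theta>"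
    using \<alpha>(2) \<gamma>(2) by (meson ereal_less_eq(3) less_imp_le order_le_less_trans)
  then obtain Q\<^sub>0 where Q\<^sub>0:
    "\<And>Q. Q\<^sub>0 \<le> Q \<Longrightarrow> \<exists>q\<ge>1. real q \<le> Q \<and> approx_error n \<theta> q < Q powr - \<alpha>"
    using uniform_exponent_gtD[OF n] by metis

  \<comment> \<open>Best approximations to \<open>\<theta>\<close> and the decay of their
    errors\<close>
  define L where "L = approx_error n \<theta>"
  have L_pos: "0 < L q" if "1 \<le> q" for q
    using approx_error_pos[OF irr n that] by (simp add: L_def)
  have "\<exists>q\<ge>1. L q < e" if "0 < e" for e
  proof -
    have "((\<lambda>Q. Q powr - \<alpha>) \<longlongrightarrow> 0) at_top"
      using half by (intro tendsto_neg_powr filterlim_ident) simp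
    then have "\<forall>\<^sub>F Q in at_top. Q powr - \<alpha> < e \<and> Q\<^sub>0 \<le> Q"
      using that by (intro eventually_conj eventually_ge_at_top order_tendstoD(2))
    then obtain Q where "Q powr - \<alpha> < e" "Q\<^sub>0 \<le> Q"
      using eventually_happens'[OF trivial_limit_at_top_linorder] by blast
    then show ?thesis
      using Q\<^sub>0[of Q] by (auto simp: L_def)
  qed
  then obtain X :: "nat \<Rightarrow> nat" where mono: "strict_mono X" and X1: "\<And>k. 1 \<le> X k"
    and best: "\<And>k q. 1 \<le> q \<Longrightarrow> q < X k \<Longrightarrow> L (X k) < L q"
    and next_best: "\<And>k q. 1 \<le> q \<Longrightarrow> q < X (Suc k) \<Longrightarrow> L (X k) \<le> L q"
    using best_approximation_sequence[of L] L_pos by metis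
  have X_pos: "0 < real (X k)" for k
    using X1[of k] by simp
  have X_top: "filterlim (\<lambda>k. real (X k)) at_top sequentially"
    using filterlim_compose[OF filterlim_real_sequentially filterlim_subseq[OF mono]] .
  have step: "X k < X (Suc k)" for k
    using mono by (simp add: strict_mono_less)
  have dec: "L (X (Suc k)) < L (X k)" for k
    using best[OF X1 step] .
  define z where "z = (\<lambda>k j. if j = 0 then int (X k) else round (real (X k) * \<theta> j))"
  have z0: "z k 0 = int (X k)" for k
    by (simp add: z_def)
  have err: "\<bar>of_int (z k j) - real (X k) * \<theta> j\<bar> \<le> L (X k)" if "j \<in> {1..n}" for k j
    using approx_error_ge[OF that, of "X k" \<theta>] that by (simp add: z_def L_def abs_minus_commute)
  have up: "\<forall>\<^sub>F k in sequentially. L (X k) \<le> 2 * real (X (Suc k)) powr - \<alpha>"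
  proof -
    have "\<forall>\<^sub>F k in sequentially. max 1 (2 * Q\<^sub>0) \<le> real (X (Suc k))"
      using X_top by (subst eventually_sequentially_Suc) (metis filterlim_at_top)
    then show ?thesis
    proof eventually_elim
      case (elim k)
      \<comment> \<open>Solutions have \<open>q \<le> Q\<close>, so the shift by 1/2 forces
        \<open>q < X (Suc k)\<close> and \<open>next_best\<close> applies. As \<open>Q\<close> is at
        least half of \<open>X (Suc k)\<close>, the loss is
        \<open>2 powr \<alpha> \<le> 2\<close>.\<close>
      define Q where "Q = real (X (Suc k)) - 1 / 2"
      have "X (Suc k) \<ge> 1"
        by (rule X1)
      then have Q: "real (X (Suc k)) / 2 \<le> Q" "Q\<^sub>0 \<le> Q"
        using elim by (auto simp: Q_def)
      then obtain q where q: "1 \<le> q" "real q \<le> Q" "L q < Q powr - \<alpha>"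
        using Q\<^sub>0[of Q] by (auto simp: L_def)
      have "q < X (Suc k)"
        using q(2) by (simp add: Q_def)
      then have "L (X k) \<le> L q"
        using next_best q(1) by blast
      also have "\<dots> \<le> Q powr - \<alpha>"
        using q(3) by simp
      also have "\<dots> \<le> (real (X (Suc k)) / 2) powr - \<alpha>"
        using Q(1) X_pos half by (intro powr_mono2') auto
      also have "\<dots> = 2 powr \<alpha> * real (X (Suc k)) powr - \<alpha>"
        by (simp add: powr_divide powr_minus field_simps)
      also have "\<dots> \<le> 2 * real (X (Suc k)) powr - \<alpha>"
        using powr_mono[OF \<alpha>(3), of 2] by (intro mult_right_mono) auto
      finally show ?case .
    qed
  qed

  \<comment> \<open>Excluding isotropic best approximations\<close>
  define F where "F = (\<lambda>k. (\<Sum>i = 1..d. (z k i)\<^sup>2) - z k 0 * z k n)"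
  \<comment> \<open>This quantity will bound the sum of the \<open>n\<close> squared minors divided
    by \<open>X (Suc k)\<close>; it tends to 0 because \<open>\<alpha> > 1/2\<close>.\<close>
  have "(\<lambda>k. 16 * real n * real (X (Suc k)) powr (1 - 2 * \<alpha>)) \<longlonglongrightarrow> 16 * real n * 0"
    using half
    by (intro tendsto_intros tendsto_neg_powr filterlim_compose[OF X_top filterlim_Suc]) auto
  then have small: "\<forall>\<^sub>F k in sequentially. 16 * real n * real (X (Suc k)) powr (1 - 2 * \<alpha>) < 1"
    by (intro order_tendstoD(2)) auto
  have "\<forall>\<^sub>F k in sequentially. F (Suc k) \<noteq> 0"
    using up small
  proof eventually_elim
    case (elim k)
    let ?q = "z (Suc k) 0" and ?q' = "z k 0"
    show ?case
    proof
      assume "F (Suc k) = 0"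
      then have iso: "(\<Sum>i = 1..d. (z (Suc k) i)\<^sup>2) = ?q * z (Suc k) n"
        by (simp add: F_def)
      have coord: "{1..n} = insert n {1..d}"
        by (auto simp: n_def)
      have "?q \<le> (\<Sum>i = 1..d. (?q' * z (Suc k) i - ?q * z k i)\<^sup>2) + (?q' * z (Suc k) n - ?q * z k n)\<^sup>2"
      proof (rule isotropic_separation[OF _ _ iso])
        show "0 < ?q"
          using X_pos[of "Suc k"] by (simp add: z0)
      next
        fix g assume g: "g dvd ?q" "\<And>i. i \<in> {1..d} \<Longrightarrow> g dvd z (Suc k) i" "g dvd z (Suc k) n"
        define h where "h = nat \<bar>g\<bar>"
        have "g dvd z (Suc k) j" if "j \<in> {1..n}" for j
          using that g(2)[of j] g(3) by (cases "j = n") (auto simp: n_def)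
        then have h: "h dvd X (Suc k)" "\<And>j. j \<in> {1..n} \<Longrightarrow> int h dvd z (Suc k) j"
          using g(1) by (auto simp: h_def z0 nat_abs_dvd_iff)
        show "is_unit g"
        proof (rule ccontr)
          assume "\<not> is_unit g"
          then have "h \<noteq> 1"
            by (auto simp: h_def)
          obtain p where p: "X (Suc k) = h * p"
            using h(1) by (elim dvdE)
          have "h \<noteq> 0" "p \<noteq> 0"
            using p X1[of "Suc k"] by (auto intro: ccontr)
          then have h2: "2 \<le> h" and p1: "1 \<le> p"
            using \<open>h \<noteq> 1\<close> by auto
          \<comment> \<open>Dividing the whole vector by a common factor \<open>h \<ge> 2\<close>
            gives a smaller denominator \<open>p\<close> with no larger error, contradicting
            \<open>best\<close>. Hence best approximations are primitive.\<close>
          have "L p \<le> L (X (Suc k))"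
            unfolding L_def
          proof (rule approx_error_le[OF n, of _ _ "\<lambda>j. z (Suc k) j div int h"])
            fix j assume j: "j \<in> {1..n}"
            have "real h * \<bar>real p * \<theta> j - of_int (z (Suc k) j div int h)\<bar>
              = \<bar>real h * (real p * \<theta> j - of_int (z (Suc k) j div int h))\<bar>"
              by (simp add: abs_mult)
            also have "real h * (real p * \<theta> j - of_int (z (Suc k) j div int h))
              = real (X (Suc k)) * \<theta> j - of_int (z (Suc k) j)"
              using h(2)[OF j] p by (auto simp: algebra_simps elim!: dvdE)
            also have "\<bar>\<dots>\<bar> \<le> L (X (Suc k))"
              using err[OF j, of "Suc k"] by (simp add: abs_minus_commute)
            finally have "real h * \<bar>real p * \<theta> j - of_int (z (Suc k) j div int h)\<bar> \<le> L (X (Suc k))" .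
            moreover have "1 * \<bar>real p * \<theta> j - of_int (z (Suc k) j div int h)\<bar>
              \<le> real h * \<bar>real p * \<theta> j - of_int (z (Suc k) j div int h)\<bar>"
              using h2 by (intro mult_right_mono) auto
            ultimately show "\<bar>real p * \<theta> j - of_int (z (Suc k) j div int h)\<bar> \<le> approx_error n \<theta> (X (Suc k))"
              by (simp add: L_def)
          qed
          moreover have "p < X (Suc k)"
            using p h2 p1 by simp
          ultimately show False
            using best[of p "Suc k"] p1 by simp
        qed
      next
        show "(\<exists>i\<in>{1..d}. ?q' * z (Suc k) i \<noteq> ?q * z k i) \<or> ?q' * z (Suc k) n \<noteq> ?q * z k n"
        proof (rule ccontr)
          assume "\<not> ?thesis"
          then have eq: "?q' * z (Suc k) j = ?q * z k j" if "j \<in> {1..n}" for j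
            using that coord by auto
          \<comment> \<open>For proportional vectors the errors scale like the denominators, so the
            earlier error would be no larger than the later one, against the strict decrease
            \<open>dec\<close>.\<close>
          have "L (X k) \<le> L (X (Suc k))"
            unfolding L_def
          proof (rule approx_error_le[OF n, of _ _ "z k"])
            fix j assume j: "j \<in> {1..n}"
            have "real (X k) * of_int (z (Suc k) j) = real (X (Suc k)) * of_int (z k j)"
              using arg_cong[OF eq[OF j], of real_of_int] by (simp add: z0)
            then have "real (X (Suc k)) * (real (X k) * \<theta> j - of_int (z k j))
              = real (X k) * (real (X (Suc k)) * \<theta> j - of_int (z (Suc k) j))"
              by (simp add: algebra_simps)
            then have "real (X (Suc k)) * \<bar>real (X k) * \<theta> j - of_int (z k j)\<bar>
              = real (X k) * \<bar>real (X (Suc k)) * \<theta> j - of_int (z (Suc k) j)\<bar>"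
              by (metis abs_mult abs_of_nat)
            also have "\<dots> \<le> real (X (Suc k)) * L (X (Suc k))"
              using err[OF j, of "Suc k"] step[of k] L_pos[OF X1]
              by (intro mult_mono) (auto simp: abs_minus_commute)
            finally show "\<bar>real (X k) * \<theta> j - of_int (z k j)\<bar> \<le> approx_error n \<theta> (X (Suc k))"
              using X_pos[of "Suc k"] by (simp add: L_def)
          qed
          then show False
            using dec[of k] by simp
        qed
      qed simp
      also have "\<dots> = (\<Sum>j = 1..n. (?q' * z (Suc k) j - ?q * z k j)\<^sup>2)"
        by (simp add: n_def)
      finally have "real (X (Suc k)) \<le> of_int (\<Sum>j = 1..n. (?q' * z (Suc k) j - ?q * z k j)\<^sup>2)"
        unfolding z0[of "Suc k"] by linarith
      also have "\<dots> = (\<Sum>j = 1..n. (real (X k) * of_int (z (Suc k) j) - real (X (Suc k)) * of_int (z k j))\<^sup>2)"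
        by (simp add: z0)
      also have "\<dots> \<le> (\<Sum>j = 1..n. (4 * real (X (Suc k)) powr (1 - \<alpha>))\<^sup>2)"
      proof (rule sum_mono)
        fix j assume j: "j \<in> {1..n}"
        \<comment> \<open>Expressed through errors, the minor is at most
          \<open>2 * X (Suc k) * L (X k)\<close>; the factor 2 in \<open>up\<close> doubles the
          constant to 4.\<close>
        have "\<bar>real (X k) * of_int (z (Suc k) j) - real (X (Suc k)) * of_int (z k j)\<bar>
          = \<bar>real (X k) * (of_int (z (Suc k) j) - real (X (Suc k)) * \<theta> j)
            - real (X (Suc k)) * (of_int (z k j) - real (X k) * \<theta> j)\<bar>"
          by (simp add: algebra_simps)
        also have "\<dots> \<le> real (X k) * \<bar>of_int (z (Suc k) j) - real (X (Suc k)) * \<theta> j\<bar>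
            + real (X (Suc k)) * \<bar>of_int (z k j) - real (X k) * \<theta> j\<bar>"
          by (intro order_trans[OF abs_triangle_ineq4]) (simp add: abs_mult)
        also have "\<dots> \<le> real (X (Suc k)) * L (X k) + real (X (Suc k)) * L (X k)"
          using err[OF j] dec[of k] step[of k] L_pos[OF X1]
          by (intro add_mono mult_mono) (auto intro: order_trans[OF _ less_imp_le])
        also have "\<dots> \<le> 4 * (real (X (Suc k)) * real (X (Suc k)) powr - \<alpha>)"
          using mult_left_mono[OF elim(1), of "real (X (Suc k))"] by (simp add: mult_ac)
        also have "\<dots> = 4 * real (X (Suc k)) powr (1 - \<alpha>)"
          using X_pos[of "Suc k"] by (simp add: powr_diff powr_minus field_simps)
        finally show "(real (X k) * of_int (z (Suc k) j) - real (X (Suc k)) * of_int (z k j))\<^sup>2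
          \<le> (4 * real (X (Suc k)) powr (1 - \<alpha>))\<^sup>2"
          by (simp only: abs_le_square_iff[symmetric])
      qed
      also have "\<dots> = real (X (Suc k)) * (16 * real n * real (X (Suc k)) powr (1 - 2 * \<alpha>))"
        using X_pos[of "Suc k"]
        by (simp add: power_mult_distrib powr_power powr_diff powr_add[symmetric] field_simps power2_eq_square)
      finally show False
        using elim(2) X_pos[of "Suc k"] by (simp add: mult_le_cancel_left1)
    qed
  qed
  then have nonzero: "\<forall>\<^sub>F k in sequentially. F k \<noteq> 0"
    by (rule eventually_sequentially_Suc[THEN iffD1])

  \<comment> \<open>Comparison of consecutive denominators\<close>
  define C where "C = 2 * (2 * (\<Sum>i = 1..d. \<bar>\<xi> i\<bar>) + real d * L (X 0) + 1)"
  have C: "2 \<le> C"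
    using L_pos[OF X1[of 0]] by (simp add: C_def sum_nonneg)
  have decseq: "decseq (\<lambda>k. L (X k))"
    using dec by (intro decseq_SucI) (simp add: less_imp_le)
  have low: "\<forall>\<^sub>F k in sequentially. real (X (Suc k)) powr \<alpha> \<le> C * real (X k)"
    using up nonzero
  proof eventually_elim
    case (elim k)
    define e where "e = (\<lambda>j. of_int (z k j) - real (X k) * \<theta> j)"
    have \<theta>_low: "\<theta> i = \<xi> i" if "i \<in> {1..d}" for i
      using that by (simp add: \<theta>_def paraboloid_point_def)
    have \<theta>_n: "\<theta> n = (\<Sum>i = 1..d. (\<xi> i)\<^sup>2)"
      by (simp add: \<theta>_def paraboloid_point_def n_def)
    \<comment> \<open>A nonzero integer has absolute value at least 1. The constant of
      \<open>paraboloid_form_bound\<close> times the factor 2 in \<open>up\<close> is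
      \<open>C\<close>.\<close>
    have "1 \<le> \<bar>real_of_int (F k)\<bar>"
      using elim(2) by linarith
    also have "real_of_int (F k) = (\<Sum>i = 1..d. (real (X k) * \<xi> i + e i)\<^sup>2)
        - real (X k) * (real (X k) * (\<Sum>i = 1..d. (\<xi> i)\<^sup>2) + e n)"
      by (simp add: F_def e_def \<theta>_low \<theta>_n z0)
    also have "\<bar>\<dots>\<bar> \<le> (2 * (\<Sum>i = 1..d. \<bar>\<xi> i\<bar>) + real d * L (X 0) + 1) * (real (X k) * L (X k))"
      using err X1[of k] L_pos[OF X1[of k]] decseqD[OF decseq, of 0 k]
      by (intro paraboloid_form_bound) (auto simp: e_def n_def)
    also have "\<dots> \<le> (2 * (\<Sum>i = 1..d. \<bar>\<xi> i\<bar>) + real d * L (X 0) + 1)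
        * (real (X k) * (2 * real (X (Suc k)) powr - \<alpha>))"
      using elim(1) C by (intro mult_left_mono) (auto simp: C_def)
    also have "\<dots> = C * real (X k) / real (X (Suc k)) powr \<alpha>"
      by (simp add: C_def powr_minus field_simps)
    finally show ?case
      using X_pos[of "Suc k"] by (simp add: field_simps)
  qed
  from eventually_conj[OF up low] obtain k\<^sub>0 where k\<^sub>0:
    "\<And>k. k\<^sub>0 \<le> k \<Longrightarrow> L (X k) \<le> 2 * real (X (Suc k)) powr - \<alpha>"
    "\<And>k. k\<^sub>0 \<le> k \<Longrightarrow> real (X (Suc k)) powr \<alpha> \<le> C * real (X k)"
    unfolding eventually_sequentially by blast
  have "(\<Sum>k = 1..n. \<alpha> ^ k) \<le> 1"
  proof (rule approximation_growth_bound[OF irr, of z "\<lambda>k. L (X k)" k\<^sub>0 C])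
    show "strict_mono (\<lambda>k. real_of_int (z k 0))"
      using mono by (simp add: z0 strict_mono_def)
    show "L (X k) \<le> C * real_of_int (z (Suc k) 0) powr - \<alpha>" if "k\<^sub>0 \<le> k" for k
      using k\<^sub>0(1)[OF that] mult_right_mono[OF C, of "real (X (Suc k)) powr - \<alpha>"] by (simp add: z0)
  qed (use err k\<^sub>0(2) below half C decseq L_pos[OF X1] X1 in \<open>auto simp: z0 less_imp_le\<close>)
  with above show False
    by simp
qed

end
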